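(* Let $G:\mathbb{N}\to\mathbb{C}$ be multiplicative and let $\mathcal{F}\subset\mathbb{P}$ be a finite, non-empty set of primes. Assume that the series $\sum_{r\ge 1,\,(r,\mathcal{F})=1}G(r)c_r(a)$ converges for every $a\in\mathbb{N}$. Then $G$ is a Ramanujan coefficient, and for every $a\in\mathbb{N}$ $$\sum_{q=1}^{\infty}G(q)c_q(a)=\Big(\sum_{s\in\mathcal{S}_{\mathcal{F}}}G(s)c_s(a)\Big)\Big(\sum_{(r,\mathcal{F})=1}G(r)c_r(a)\Big),$$ where the first factor on the right is a finite Euler product: $$\sum_{q=1}^{\infty}G(q)c_q(a)=\Big(\prod_{p\in\mathcal{F}}\sum_{K=0}^{v_p(a)}p^K\big(G(p^K)-G(p^{K+1})\big)\Big)\Big(\sum_{(r,\mathcal{F})=1}G(r)c_r(a)\Big).$$ In particular, if $G\neq 0$ is multiplicative and, for each $d\in\mathbb{N}$, the series $\sum_{(r,d)=1}G(r)\mu(r)$ converges, then for every $d\in\mathbb{N}$ $$\sum_{q=1}^{\infty}G(q)\mu(q)=\prod_{p\mid d}(1-G(p))\cdot\sum_{(r,d)=1}G(r)\mu(r).$$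
   Context: $\mathbb{N}=\{1,2,\dots\}$, $\mathbb{N}_0=\mathbb{N}\cup\{0\}$, $\mathbb{P}$ is the set of primes. The Ramanujan sum is $c_q(a)=\sum_{1\le j\le q,\,(j,q)=1}e^{2\pi i ja/q}$ (so $c_q(1)=\mu(q)$). An arithmetic function $G:\mathbb{N}\to\mathbb{C}$ is called a Ramanujan coefficient if the series $\sum_{q=1}^\infty G(q)c_q(a)$ converges for every $a\in\mathbb{N}$. For a set of primes $\mathcal{P}$, $\mathcal{S}_{\mathcal{P}}=\{s\in\mathbb{N}: s=1\text{ or } (p\mid s\Rightarrow p\in\mathcal{P})\}$. For $r\in\mathbb{N}$, $(r,\mathcal{F})=1$ means $r$ is coprime to every element of $\mathcal{F}$. $v_p(a)=\max\{K\in\mathbb{N}_0: p^K\mid a\}$ is the $p$-adic valuation. Series over $r$ are summed in increasing order of $r$. *)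

theory Defs
  imports "HOL-Analysis.Analysis" "HOL-Computational_Algebra.Computational_Algebra"
begin

(* Arithmetic functions live on the positive integers; they are modelled as functions on nat
   whose value at 0 is never used. *)

definition ramanujan_sum :: "nat \<Rightarrow> nat \<Rightarrow> complex" where
  "ramanujan_sum q a =
     (\<Sum>j | 1 \<le> j \<and> j \<le> q \<and> coprime j q.
        exp (2 * complex_of_real pi * \<i> * of_nat j * of_nat a / of_nat q))"

definition moebius_mu :: "nat \<Rightarrow> int" where
  "moebius_mu n = (if squarefree n then (-1) ^ card (prime_factors n) else 0)"

(* The zero function counts as multiplicative. *)
definition multiplicative_function :: "(nat \<Rightarrow> complex) \<Rightarrow> bool" where
  "multiplicative_function G \<longleftrightarrow>
     (\<forall>m n. 1 \<le> m \<longrightarrow> 1 \<le> n \<longrightarrow> coprime m n \<longrightarrow> G (m * n) = G m * G n)"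

(* Series over an index set A of naturals, summed in increasing order of the index; it may
   converge only conditionally, so the unordered infsum is not appropriate. *)
definition converges_over :: "nat set \<Rightarrow> (nat \<Rightarrow> complex) \<Rightarrow> bool" where
  "converges_over A f \<longleftrightarrow> summable (\<lambda>n. if n \<in> A then f n else 0)"

definition series_over :: "nat set \<Rightarrow> (nat \<Rightarrow> complex) \<Rightarrow> complex" where
  "series_over A f = (\<Sum>n. if n \<in> A then f n else 0)"

definition ramanujan_coefficient :: "(nat \<Rightarrow> complex) \<Rightarrow> bool" where
  "ramanujan_coefficient G \<longleftrightarrow>
     (\<forall>a\<ge>1. converges_over {1..} (\<lambda>q. G q * ramanujan_sum q a))"

definition smooth_numbers :: "nat set \<Rightarrow> nat set" where
  "smooth_numbers P = {s. 1 \<le> s \<and> (s = 1 \<or> (\<forall>p. prime p \<longrightarrow> p dvd s \<longrightarrow> p \<in> P))}"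

definition coprime_numbers :: "nat set \<Rightarrow> nat set" where
  "coprime_numbers F = {r. 1 \<le> r \<and> (\<forall>f\<in>F. coprime r f)}"

end

(* For fixed a the summand h(q) = G(q) c_q(a) is multiplicative, and h(p^k) = 0 for k > v_p(a) + 1.
   Splitting an integer n as p^k r with p not dividing r thus writes the series over integers
   coprime to F as a finite sum, over k, of copies of h(p^k) times the series over integers coprime
   to F and p, stretched by p^k.  Stretching preserves even conditional convergence, so the primes
   of F can be peeled off one at a time.  The smooth series is the same statement applied to h
   restricted to smooth numbers, whose coprime series has the single term h(1).  The local factors
   are found by summation by parts from c_{p^k}(a) = g(k) - g(k-1), with g(k) = p^k if p^k divides a
   and 0 otherwise.  The last claim is the case a = 1, as c_q(1) = mu(q). *)

theory Submission
  imports Defs "HOL-Number_Theory.Totient"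
begin

section \<open>Additive characters modulo q and Ramanujan sums at prime powers\<close>

text \<open>This is the character usually written e(x/q). Having \<open>x\<close> range over
  naturals lets the index sets be \<open>totatives q\<close> and \<open>{0<..q}\<close> without
  coercions.\<close>

definition root_char :: "nat \<Rightarrow> nat \<Rightarrow> complex" where
  "root_char q x = exp (2 * complex_of_real pi * \<i> * of_nat x / of_nat q)"

lemma root_char_add: "root_char q (x + y) = root_char q x * root_char q y"
  by (simp add: root_char_def flip: exp_add) (simp add: ring_distribs add_divide_distrib)

lemma root_char_mult: "root_char q (j * x) = root_char q x ^ j"
  by (induction j) (simp_all add: root_char_add, simp add: root_char_def)

lemma root_char_cancel: "k > 0 \<Longrightarrow> root_char (k * q) (k * x) = root_char q x"
  by (simp add: root_char_def mult.assoc mult.left_commute[of _ "of_nat k"])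

lemma root_char_eq_1_iff:
  assumes "q > 0"
  shows "root_char q x = 1 \<longleftrightarrow> q dvd x"
proof -
  have cancel: "2 * pi * s = 2 * t * pi \<longleftrightarrow> s = t" for s t
    by simp
  have "root_char q x = exp (\<i> * complex_of_real (2 * pi * (real x / real q)))"
    by (simp add: root_char_def algebra_simps)
  also have "\<dots> = 1 \<longleftrightarrow> (\<exists>n::int. 2 * pi * (real x / real q) = 2 * of_int n * pi)"
    by (simp add: exp_eq_1)
  also have "\<dots> \<longleftrightarrow> (\<exists>n::int. real x / real q = of_int n)"
    by (simp only: cancel)
  also have "\<dots> \<longleftrightarrow> (\<exists>n::int. int x = n * int q)"
  proof (intro ex_cong1)
    fix n :: int
    have "real x / real q = of_int n \<longleftrightarrow> real_of_int (int x) = real_of_int (n * int q)"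
      using assms by (simp add: divide_eq_eq)
    then show "real x / real q = of_int n \<longleftrightarrow> int x = n * int q"
      by (simp only: of_int_eq_iff)
  qed
  also have "\<dots> \<longleftrightarrow> q dvd x"
    by (metis dvd_def int_dvd_int_iff mult.commute)
  finally show ?thesis .
qed

lemma root_char_mod: "root_char q (x mod q) = root_char q x"
proof (cases "q = 0")
  case False
  have "root_char q x = root_char q (x mod q + q * (x div q))"
    by simp
  also have "\<dots> = root_char q (x mod q) * root_char q (q * (x div q))"
    by (rule root_char_add)
  also have "root_char q (q * (x div q)) = 1"
    using False by (simp add: root_char_eq_1_iff)
  finally show ?thesis by simp
qed simp

lemma ramanujan_sum_conv_totatives:
  "ramanujan_sum q a = (\<Sum>j\<in>totatives q. root_char q (j * a))"
  unfolding ramanujan_sum_def root_char_def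
  by (intro sum.cong) (auto simp: in_totatives_iff mult.assoc)

text \<open>Orthogonality: the terms are powers of the q-th root of unity \<open>w\<close>, so the
  geometric sum vanishes unless \<open>w = 1\<close>. The range \<open>{0<..q}\<close> is the one in
  which \<open>totatives q\<close> lies.\<close>

lemma sum_root_char:
  assumes "q > 0"
  shows "(\<Sum>j\<in>{0<..q}. root_char q (j * a)) = (if q dvd a then of_nat q else 0)"
proof -
  define w where "w = root_char q a"
  have wq: "w ^ q = 1"
    using assms by (simp add: w_def root_char_eq_1_iff flip: root_char_mult)
  have "(\<Sum>j\<in>{0<..q}. root_char q (j * a)) = (\<Sum>j\<in>{0<..q}. w ^ j)"
    by (simp add: root_char_mult w_def)
  also have "\<dots> = (\<Sum>j<q. w ^ Suc j)"
    by (rule sum.reindex_bij_witness[of _ Suc "\<lambda>j. j - 1"]) auto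
  also have "\<dots> = w * (\<Sum>j<q. w ^ j)"
    by (simp add: sum_distrib_left)
  also have "\<dots> = (if w = 1 then of_nat q else 0)"
    by (simp add: geometric_sum wq)
  finally show ?thesis
    using assms by (simp add: w_def root_char_eq_1_iff)
qed

lemma ramanujan_sum_1: "ramanujan_sum (Suc 0) a = 1"
  using root_char_eq_1_iff[of 1 a] by (simp add: ramanujan_sum_conv_totatives)

text \<open>The totatives of \<open>p ^ Suc n\<close> are all residues minus the multiples
  \<open>p * m\<close>. Cancelling \<open>p\<close> turns the sum over these multiples into a full
  character sum modulo \<open>p ^ n\<close>, and orthogonality evaluates both sums.\<close>

lemma ramanujan_sum_prime_power_Suc:
  assumes "prime p"
  shows "ramanujan_sum (p ^ Suc n) a =
    (if p ^ Suc n dvd a then of_nat p ^ Suc n else 0) - (if p ^ n dvd a then of_nat p ^ n else 0)"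
proof -
  have p: "p > 0"
    using assms prime_gt_0_nat by blast
  have "ramanujan_sum (p ^ Suc n) a = (\<Sum>j\<in>{0<..p ^ Suc n}. root_char (p ^ Suc n) (j * a))
      - (\<Sum>j\<in>(\<lambda>m. p * m) ` {0<..p ^ n}. root_char (p ^ Suc n) (j * a))"
    unfolding ramanujan_sum_conv_totatives totatives_prime_power_Suc[OF assms]
    by (rule sum_diff) (use p in auto)
  also have "(\<Sum>j\<in>(\<lambda>m. p * m) ` {0<..p ^ n}. root_char (p ^ Suc n) (j * a)) =
      (\<Sum>j\<in>{0<..p ^ n}. root_char (p ^ n) (j * a))"
    using p by (subst sum.reindex) (auto simp: inj_on_def root_char_cancel mult.assoc)
  finally show ?thesis
    using p by (simp add: sum_root_char del: power_Suc) 
qed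

section \<open>Multiplicativity of the Ramanujan sum in its modulus\<close>

text \<open>A Chinese remainder bijection in the form that suits characters, because (jn + km)/(mn)
  = j/m + k/n. Moduli above 1 make every totative strictly smaller than its modulus; for
  \<open>m = n = 1\<close> the residue would be 0, which is no totative.\<close>

lemma bij_betw_totatives_mult:
  assumes "m > 1" "n > 1" "coprime m n"
  shows "bij_betw (\<lambda>(j, k). (j * n + k * m) mod (m * n)) (totatives m \<times> totatives n) (totatives (m * n))"
proof -
  let ?f = "\<lambda>(j, k). (j * n + k * m) mod (m * n)"
  have inj: "inj_on ?f (totatives m \<times> totatives n)"
  proof (intro inj_onI, clarify)
    fix j k j' k'
    assume j: "j \<in> totatives m" "j' \<in> totatives m" and k: "k \<in> totatives n" "k' \<in> totatives n"
      and "(j * n + k * m) mod (m * n) = (j' * n + k' * m) mod (m * n)"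
    then have *: "[j * n + k * m = j' * n + k' * m] (mod m * n)"
      by (simp add: cong_def)
    then have "[j * n = j' * n] (mod m)"
      using cong_modulus_mult_nat[OF *] by (simp add: cong_def)
    then have "[j = j'] (mod m)"
      using assms by (simp add: cong_mult_rcancel_nat coprime_commute)
    moreover have "[k * m = k' * m] (mod n)"
      using * cong_modulus_mult_nat[of "j * n + k * m" "j' * n + k' * m" n m]
      by (simp add: cong_def mult.commute)
    then have "[k = k'] (mod n)"
      using assms by (simp add: cong_mult_rcancel_nat coprime_commute)
    \<comment> \<open>Congruent totatives are equal, both being below the modulus.\<close>
    ultimately show "j = j' \<and> k = k'"
      using j k assms by (metis cong_less_modulus_unique_nat totatives_less)
  qed
  have "?f ` (totatives m \<times> totatives n) \<subseteq> totatives (m * n)"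
  proof clarify
    fix j k assume j: "j \<in> totatives m" and k: "k \<in> totatives n"
    let ?x = "(j * n + k * m) mod (m * n)"
    have "coprime (j * n) m" "coprime (k * m) n"
      using j k assms by (simp_all add: in_totatives_iff coprime_commute)
    then have "coprime (j * n + k * m) m" "coprime (j * n + k * m) n"
      by (metis coprime_iff_gcd_eq_1 gcd_add_mult gcd.commute add.commute mult.commute)+
    then have "coprime ?x (m * n)"
      using assms by (metis coprime_mod_left_iff coprime_mult_right_iff gr_implies_not_zero mult_eq_0_iff)
    moreover have "?x > 0"
    proof (rule ccontr)
      assume "\<not> ?x > 0"
      with \<open>coprime ?x (m * n)\<close> assms show False by simp
    qed
    moreover have "?x \<le> m * n"
      using assms by (simp add: less_imp_le)
    ultimately show "?x \<in> totatives (m * n)"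
      by (simp add: in_totatives_iff)
  qed
  \<comment> \<open>Surjectivity comes from counting: the image lies in
    \<open>totatives (m * n)\<close> and has the same size, as the totient is
    multiplicative.\<close>
  moreover have "card (?f ` (totatives m \<times> totatives n)) = card (totatives (m * n))"
    using assms inj totient_mult_coprime[of m n]
    by (simp add: card_image card_cartesian_product totient_def)
  ultimately have "?f ` (totatives m \<times> totatives n) = totatives (m * n)"
    by (intro card_subset_eq) auto
  with inj show ?thesis
    by (simp add: bij_betw_def)
qed

lemma ramanujan_sum_mult:
  assumes "coprime m n" "m > 0" "n > 0"
  shows "ramanujan_sum (m * n) a = ramanujan_sum m a * ramanujan_sum n a"
proof (cases "m = 1 \<or> n = 1")
  case True
  then show ?thesis by (auto simp: ramanujan_sum_1)
next
  case False
  with assms have mn: "m > 1" "n > 1" by auto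
  \<comment> \<open>Reduction modulo \<open>m * n\<close> does not affect the character, and the
    fraction splits as ja/m + ka/n.\<close>
  have char: "root_char (m * n) ((j * n + k * m) mod (m * n) * a) =
      root_char m (j * a) * root_char n (k * a)" for j k
  proof -
    have "root_char (m * n) ((j * n + k * m) mod (m * n) * a) =
        root_char (m * n) ((j * n + k * m) * a)"
      by (metis root_char_mod mod_mult_left_eq)
    also have "\<dots> = root_char (n * m) (n * (j * a)) * root_char (m * n) (m * (k * a))"
      by (simp add: algebra_simps flip: root_char_add)
    finally show ?thesis
      using assms by (simp add: root_char_cancel)
  qed
  have "ramanujan_sum (m * n) a = (\<Sum>(j, k)\<in>totatives m \<times> totatives n.
      root_char (m * n) ((j * n + k * m) mod (m * n) * a))"
    unfolding ramanujan_sum_conv_totatives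
    using sum.reindex_bij_betw[OF bij_betw_totatives_mult[OF mn assms(1)],
        of "\<lambda>x. root_char (m * n) (x * a)"]
    by (simp add: case_prod_unfold)
  also have "\<dots> = ramanujan_sum m a * ramanujan_sum n a"
    unfolding ramanujan_sum_conv_totatives char
    by (simp add: sum_product sum.cartesian_product)
  finally show ?thesis .
qed

section \<open>The Ramanujan sum at 1 and the Moebius function\<close>

text \<open>Strong induction, splitting off the full power \<open>p ^ Suc k\<close> of one prime
  divisor. At the argument 1 this power contributes -1 if \<open>k = 0\<close> and 0 otherwise:
  either one new prime flips the sign, or \<open>q\<close> is not squarefree.\<close>

lemma ramanujan_sum_at_1:
  "q > 0 \<Longrightarrow> ramanujan_sum q 1 = of_int (moebius_mu q)"
proof (induction q rule: less_induct)
  case (less q)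
  show ?case
  proof (cases "q = 1")
    case True
    then show ?thesis by (simp add: ramanujan_sum_1 moebius_mu_def)
  next
    case False
    then obtain p where p: "prime p" "p dvd q"
      using prime_factor_nat by blast
    then have p2: "p > 1"
      using prime_gt_1_nat by blast
    obtain r where r: "q = p ^ multiplicity p q * r" "\<not> p dvd r"
      using multiplicity_decompose'[of q p] p less.prems not_prime_unit by (metis not_gr_zero)
    obtain k where k: "multiplicity p q = Suc k"
      using p less.prems multiplicity_eq_zero_iff[of q p] p2 by (cases "multiplicity p q") auto
    from r k have q: "q = p ^ Suc k * r" by simp
    have r0: "r > 0" using q less.prems by (auto intro: Nat.gr0I)
    have "1 < p ^ Suc k" using p2 by (intro one_less_power) simp_all
    with r0 have "r < q" unfolding q by simp
    have cop: "coprime p r" using p r(2) by (simp add: prime_imp_coprime)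
    have "ramanujan_sum q 1 = ramanujan_sum (p ^ Suc k) 1 * of_int (moebius_mu r)"
      unfolding q using less.IH[OF \<open>r < q\<close> r0] r0 p2 cop
      by (subst ramanujan_sum_mult) (auto simp del: power_Suc)
    also have "ramanujan_sum (p ^ Suc k) 1 = (if k = 0 then -1 else 0)"
      using p2 p(1) by (subst ramanujan_sum_prime_power_Suc) (auto simp del: power_Suc)
    also have "(if k = 0 then -1 else 0) * of_int (moebius_mu r) = (of_int (moebius_mu q) :: complex)"
    proof (cases "k = 0")
      case True
      have "squarefree q \<longleftrightarrow> squarefree r"
        using True cop p(1) unfolding q
        by (auto intro: squarefree_mult_coprime squarefree_prime dest: squarefree_multD)
      moreover have "prime_factors q = insert p (prime_factors r)"
        using True p(1) r0 p2 unfolding q by (simp add: prime_factors_product prime_prime_factors)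
      moreover have "p \<notin> prime_factors r" using r(2) by auto
      ultimately show ?thesis using True by (simp add: moebius_mu_def)
    next
      case False
      have "\<not> squarefree q"
      proof
        assume "squarefree q"
        then have "squarefree (p ^ Suc k)" unfolding q by (rule squarefree_multD)
        then show False using False p2 by (simp add: squarefree_power_iff del: power_Suc)
      qed
      with False show ?thesis by (simp add: moebius_mu_def)
    qed
    finally show ?thesis .
  qed
qed

section \<open>Peeling primes off a series over coprime integers\<close>

text \<open>The elements of \<open>F\<close> are primes other than \<open>p\<close>, so the factor
  \<open>p ^ k\<close> has no bearing on coprimality to \<open>F\<close>.\<close>

lemma coprime_numbers_insert_mult:
  assumes "prime p" "p \<notin> F" "\<forall>f\<in>F. prime f" "\<not> p dvd r"
  shows "p ^ k * r \<in> coprime_numbers F \<longleftrightarrow> r \<in> coprime_numbers (insert p F)"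
proof -
  have "coprime p f" if "f \<in> F" for f
    using assms that by (metis primes_coprime)
  moreover have "p > 0" using assms(1) prime_gt_0_nat by blast
  moreover have "coprime r p"
    using assms by (simp add: prime_imp_coprime coprime_commute)
  ultimately show ?thesis
    unfolding coprime_numbers_def by (auto simp: Suc_le_eq)
qed

lemma sums_coprime_numbers_remove_prime:
  fixes h :: "nat \<Rightarrow> complex"
  assumes "multiplicative_function h" and p: "prime p" and F: "p \<notin> F" "\<forall>f\<in>F. prime f"
    and vanish: "\<And>k. k > N \<Longrightarrow> h (p ^ k) = 0"
    and R: "(\<lambda>n. if n \<in> coprime_numbers (insert p F) then h n else 0) sums R"
  shows "(\<lambda>n. if n \<in> coprime_numbers F then h n else 0) sums ((\<Sum>k\<le>N. h (p ^ k)) * R)"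
proof -
  let ?C = "coprime_numbers F" and ?C' = "coprime_numbers (insert p F)"
  have p2: "p > 1"
    using p prime_gt_1_nat by blast
  have C': "r > 0" "\<not> p dvd r" "coprime p r" if "r \<in> ?C'" for r
    using that p2 unfolding coprime_numbers_def
    by (auto simp: coprime_commute dest: coprime_common_divisor_nat[of p r p])
  \<comment> \<open>\<open>f k\<close> isolates the terms whose index has p-adic valuation exactly
    \<open>k\<close> and is coprime to \<open>F\<close>.\<close>
  define f where "f k n = (if p ^ k dvd n \<and> n div p ^ k \<in> ?C' then h n else 0)" for k n
  have "f k sums (h (p ^ k) * R)" for k
  proof -
    have "(\<lambda>r. h (p ^ k) * (if r \<in> ?C' then h r else 0)) sums (h (p ^ k) * R)"
      by (rule sums_mult[OF R])
    also have "(\<lambda>r. h (p ^ k) * (if r \<in> ?C' then h r else 0)) = (\<lambda>r. f k (p ^ k * r))"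
    proof
      fix r
      show "h (p ^ k) * (if r \<in> ?C' then h r else 0) = f k (p ^ k * r)"
        using assms(1) C'[of r] p2 by (auto simp: f_def multiplicative_function_def Suc_le_eq)
    qed
    finally have "(\<lambda>r. f k (p ^ k * r)) sums (h (p ^ k) * R)" .
    moreover have "strict_mono (\<lambda>r. p ^ k * r)"
      using p2 by (auto simp: strict_mono_def)
    \<comment> \<open>Stretching along an increasing map only inserts zeros and keeps the order of
      the terms, so no absolute convergence is required.\<close>
    moreover have "f k n = 0" if "n \<notin> range (\<lambda>r. p ^ k * r)" for n
      using that by (auto simp: f_def)
    ultimately show ?thesis
      using sums_mono_reindex[of "\<lambda>r. p ^ k * r" "f k"] by blast
  qed
  then have "(\<lambda>n. \<Sum>k\<le>N. f k n) sums (\<Sum>k\<le>N. h (p ^ k) * R)"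
    by (intro sums_sum)
  moreover have "(\<Sum>k\<le>N. f k n) = (if n \<in> ?C then h n else 0)" for n
  proof (cases "n = 0")
    case True
    then show ?thesis by (simp add: f_def coprime_numbers_def)
  next
    case False
    obtain r where r: "n = p ^ multiplicity p n * r" "\<not> p dvd r"
      using multiplicity_decompose'[of n p] False p not_prime_unit by metis
    define m where "m = multiplicity p n"
    have n: "n = p ^ m * r" using r by (simp add: m_def)
    \<comment> \<open>Each positive \<open>n\<close> is seen by one piece only, the one whose
      \<open>k\<close> is the valuation \<open>m\<close> of \<open>n\<close>.\<close>
    have eq: "f k n = (if k = m then if n \<in> ?C then h n else 0 else 0)" for k
    proof (cases "p ^ k dvd n \<and> n div p ^ k \<in> ?C'")
      case True
      then obtain s where s: "n = p ^ k * s" by auto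
      with True p2 have "s \<in> ?C'" by simp
      then have "\<not> p dvd s" by (rule C')
      with s p have "m = k"
        unfolding m_def by (intro multiplicity_eqI) auto
      with s True show ?thesis
        using coprime_numbers_insert_mult[OF p F \<open>\<not> p dvd s\<close>] \<open>s \<in> ?C'\<close> by (simp add: f_def)
    next
      case nC: False
      have "n \<notin> ?C" if "k = m"
        using nC that coprime_numbers_insert_mult[OF p F r(2), of m] p2 by (auto simp: n)
      with nC show ?thesis by (auto simp: f_def)
    qed
    \<comment> \<open>For \<open>m > N\<close> the matching piece is missing from the sum over
      \<open>k\<le>N\<close>, so the term itself must vanish.\<close>
    have "h n = 0" if "m > N"
    proof -
      have "coprime p r" using p r(2) by (simp add: prime_imp_coprime)
      moreover have "r > 0" using n False by (auto intro: Nat.gr0I)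
      ultimately have "h n = h (p ^ m) * h r"
        using assms(1) p2 unfolding n by (auto simp: multiplicative_function_def Suc_le_eq)
      with vanish[OF that] show ?thesis by simp
    qed
    then show ?thesis
      by (auto simp: eq)
  qed
  ultimately show ?thesis
    by (simp add: sum_distrib_right)
qed

text \<open>Induction on \<open>F\<close> with \<open>R\<close> arbitrary: removing \<open>p\<close>
  multiplies the value of the coprime series by a local factor, and the induction hypothesis is
  applied to this new value. For empty \<open>F\<close> the coprime series is the full
  series.\<close>

lemma sums_finite_euler_product:
  fixes h :: "nat \<Rightarrow> complex"
  assumes "multiplicative_function h" "finite F" "\<forall>p\<in>F. prime p"
    and "\<And>p k. p \<in> F \<Longrightarrow> k > N p \<Longrightarrow> h (p ^ k) = 0"
    and "(\<lambda>n. if n \<in> coprime_numbers F then h n else 0) sums R"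
  shows "(\<lambda>n. if n \<in> {1..} then h n else 0) sums ((\<Prod>p\<in>F. \<Sum>k\<le>N p. h (p ^ k)) * R)"
  using assms(2-)
proof (induction F arbitrary: R rule: finite_induct)
  case empty
  then show ?case by (simp add: coprime_numbers_def)
next
  case (insert p F)
  have "(\<lambda>n. if n \<in> coprime_numbers F then h n else 0) sums ((\<Sum>k\<le>N p. h (p ^ k)) * R)"
    using insert.prems insert.hyps
    by (intro sums_coprime_numbers_remove_prime[OF assms(1)]) auto
  with insert.IH[OF _ _ this] insert.prems insert.hyps show ?case
    by (simp add: mult_ac)
qed

section \<open>Series over smooth numbers\<close>

lemma smooth_numbers_mult_iff:
  assumes "m > 0" "n > 0"
  shows "m * n \<in> smooth_numbers F \<longleftrightarrow> m \<in> smooth_numbers F \<and> n \<in> smooth_numbers F"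
  using assms unfolding smooth_numbers_def by (auto simp: Suc_le_eq prime_dvd_mult_iff)

text \<open>Reduces the coprime series of a function supported on smooth numbers to its term at
  1.\<close>

lemma smooth_coprime_eq_1:
  assumes "n \<in> smooth_numbers F" "n \<in> coprime_numbers F"
  shows "n = 1"
proof (rule ccontr)
  assume "n \<noteq> 1"
  then obtain p where p: "prime p" "p dvd n" using prime_factor_nat by blast
  then have "p \<in> F" using assms \<open>n \<noteq> 1\<close> by (auto simp: smooth_numbers_def)
  then have "coprime n p" using assms by (auto simp: coprime_numbers_def)
  with p show False by (metis coprime_absorb_right not_prime_unit)
qed

text \<open>The factor \<open>h 1\<close> is the coprime series of the restricted function. It has
  to be kept because \<open>h\<close> may be zero; for empty \<open>F\<close> it is the whole
  sum.\<close>

lemma sums_smooth_numbers: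
  fixes h :: "nat \<Rightarrow> complex"
  assumes "multiplicative_function h" "finite F" "\<forall>p\<in>F. prime p"
    and "\<And>p k. p \<in> F \<Longrightarrow> k > N p \<Longrightarrow> h (p ^ k) = 0"
  shows "(\<lambda>n. if n \<in> smooth_numbers F then h n else 0) sums ((\<Prod>p\<in>F. \<Sum>k\<le>N p. h (p ^ k)) * h 1)"
proof -
  define g where "g n = (if n \<in> smooth_numbers F then h n else 0)" for n
  have "multiplicative_function g"
    using assms(1) by (auto simp: multiplicative_function_def g_def smooth_numbers_mult_iff)
  moreover have "(\<lambda>n. if n \<in> coprime_numbers F then g n else 0) = (\<lambda>n. if n = 1 then h n else 0)"
    using smooth_coprime_eq_1[of _ F]
    by (auto simp: fun_eq_iff g_def smooth_numbers_def coprime_numbers_def)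
  then have "(\<lambda>n. if n \<in> coprime_numbers F then g n else 0) sums h 1"
    using sums_single[of 1 h] by simp
  \<comment> \<open>Powers of primes in \<open>F\<close> are smooth, so restricting \<open>h\<close>
    leaves the local factors unchanged.\<close>
  moreover have gp: "g (p ^ k) = h (p ^ k)" if "p \<in> F" for p k
  proof -
    have "p ^ k \<in> smooth_numbers F"
    proof -
      have "q \<in> F" if "prime q" "q dvd p ^ k" for q
        using that assms(3) \<open>p \<in> F\<close> by (metis prime_dvd_power primes_dvd_imp_eq)
      with that assms(3) prime_gt_0_nat[of p] show ?thesis
        unfolding smooth_numbers_def by (auto simp: Suc_le_eq)
    qed
    then show ?thesis by (simp add: g_def)
  qed
  ultimately have "(\<lambda>n. if n \<in> {1..} then g n else 0) sums ((\<Prod>p\<in>F. \<Sum>k\<le>N p. g (p ^ k)) * h 1)"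
    using assms by (intro sums_finite_euler_product) auto
  also have "(\<lambda>n. if n \<in> {1..} then g n else 0) = (\<lambda>n. if n \<in> smooth_numbers F then h n else 0)"
    by (auto simp: fun_eq_iff g_def smooth_numbers_def)
  finally show ?thesis by (simp add: gp)
qed

section \<open>Local factors of a Ramanujan expansion\<close>

lemma multiplicative_function_ramanujan:
  "multiplicative_function G \<Longrightarrow> multiplicative_function (\<lambda>q. G q * ramanujan_sum q a)"
  by (simp add: multiplicative_function_def ramanujan_sum_mult)

lemma prime_power_dvd_iff_le_multiplicity:
  fixes p a :: nat
  assumes "prime p" "a > 0"
  shows "p ^ k dvd a \<longleftrightarrow> k \<le> multiplicity p a"
  using assms by (metis not_gr_zero not_prime_unit power_dvd_iff_le_multiplicity)

text \<open>Vanishing starts only beyond \<open>Suc (multiplicity p a)\<close>: at that exponent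
  itself the sum is still minus \<open>p ^ multiplicity p a\<close>.\<close>

lemma ramanujan_sum_prime_power_eq_0:
  assumes "prime p" "a > 0" "k > Suc (multiplicity p a)"
  shows "ramanujan_sum (p ^ k) a = 0"
proof -
  obtain n where k: "k = Suc n" "n > multiplicity p a"
    using assms(3) by (cases k) auto
  have "\<not> p ^ n dvd a" "\<not> p ^ Suc n dvd a"
    using k assms by (simp_all add: prime_power_dvd_iff_le_multiplicity del: power_Suc)
  then show ?thesis
    unfolding k using assms(1) by (simp add: ramanujan_sum_prime_power_Suc del: power_Suc)
qed

lemma sum_ramanujan_prime_powers:
  fixes G :: "nat \<Rightarrow> complex"
  assumes "prime p" "a > 0"
  shows "(\<Sum>k\<le>Suc (multiplicity p a). G (p ^ k) * ramanujan_sum (p ^ k) a) =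
    (\<Sum>K = 0..multiplicity p a. of_nat p ^ K * (G (p ^ K) - G (p ^ (K + 1))))"
proof -
  let ?v = "multiplicity p a"
  \<comment> \<open>\<open>b k\<close> is the full character sum modulo \<open>p ^ k\<close>; its
    differences are the Ramanujan sums at prime powers.\<close>
  define b :: "nat \<Rightarrow> complex" where "b k = (if p ^ k dvd a then of_nat p ^ k else 0)" for k
  have b: "b k = (if k \<le> ?v then of_nat p ^ k else 0)" for k
    using assms by (simp add: b_def prime_power_dvd_iff_le_multiplicity)
  have b0: "b 0 = 1"
    by (simp add: b_def)
  have c: "ramanujan_sum (p ^ Suc n) a = b (Suc n) - b n" for n
    using ramanujan_sum_prime_power_Suc[OF assms(1)] by (simp add: b_def)
  \<comment> \<open>Summation by parts up to any \<open>n\<close>, with its boundary term, so that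
    induction applies.\<close>
  have "(\<Sum>k\<le>Suc n. G (p ^ k) * ramanujan_sum (p ^ k) a) =
      (\<Sum>K = 0..n. b K * (G (p ^ K) - G (p ^ (K + 1)))) + b (Suc n) * G (p ^ Suc n)" for n
  proof (induction n)
    case 0
    show ?case
      using c[of 0] by (simp add: b0 ramanujan_sum_1 right_diff_distrib)
  next
    case (Suc n)
    show ?case
      unfolding sum.atMost_Suc[where n = "Suc n"] Suc.IH c by (simp add: algebra_simps)
  qed
  \<comment> \<open>At \<open>n = ?v\<close> the boundary term disappears, since
    \<open>b (Suc ?v) = 0\<close>.\<close>
  from this[of ?v] show ?thesis by (simp add: b)
qed

lemma multiplicative_function_at_1:
  assumes "multiplicative_function G" "n \<ge> 1" "G n \<noteq> 0"
  shows "G 1 = 1"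
proof -
  have "G (n * 1) = G n * G 1"
    using assms unfolding multiplicative_function_def by (metis coprime_1_right le_refl)
  with assms(3) show ?thesis by simp
qed

section \<open>The full expansion and its smooth factor\<close>

text \<open>Empty \<open>F\<close> is allowed, which later covers \<open>d = 1\<close> in the
  Moebius case.\<close>

lemma ramanujan_expansion_euler_sums:
  fixes G :: "nat \<Rightarrow> complex"
  assumes "multiplicative_function G" "finite F" "\<forall>p\<in>F. prime p" "a > 0"
    and "converges_over (coprime_numbers F) (\<lambda>r. G r * ramanujan_sum r a)"
  shows "(\<lambda>n. if n \<in> {1..} then G n * ramanujan_sum n a else 0) sums
    ((\<Prod>p\<in>F. \<Sum>K = 0..multiplicity p a. of_nat p ^ K * (G (p ^ K) - G (p ^ (K + 1)))) *
     series_over (coprime_numbers F) (\<lambda>r. G r * ramanujan_sum r a))"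
proof -
  have "(\<lambda>n. if n \<in> {1..} then G n * ramanujan_sum n a else 0) sums
    ((\<Prod>p\<in>F. \<Sum>k\<le>Suc (multiplicity p a). G (p ^ k) * ramanujan_sum (p ^ k) a) *
     series_over (coprime_numbers F) (\<lambda>r. G r * ramanujan_sum r a))"
    using assms summable_sums unfolding converges_over_def series_over_def
    by (intro sums_finite_euler_product multiplicative_function_ramanujan)
       (auto simp: ramanujan_sum_prime_power_eq_0)
  also have "(\<Prod>p\<in>F. \<Sum>k\<le>Suc (multiplicity p a). G (p ^ k) * ramanujan_sum (p ^ k) a) =
      (\<Prod>p\<in>F. \<Sum>K = 0..multiplicity p a. of_nat p ^ K * (G (p ^ K) - G (p ^ (K + 1))))"
    using assms by (intro prod.cong sum_ramanujan_prime_powers) auto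
  finally show ?thesis .
qed

text \<open>The leftover factor at 1 equals 1 unless \<open>G\<close> vanishes on the positive
  integers. In that case \<open>F \<noteq> {}\<close> makes the product 0 as well, whereas an empty
  product would be 1.\<close>

lemma ramanujan_smooth_sums:
  fixes G :: "nat \<Rightarrow> complex"
  assumes "multiplicative_function G" "finite F" "F \<noteq> {}" "\<forall>p\<in>F. prime p" "a > 0"
  shows "(\<lambda>n. if n \<in> smooth_numbers F then G n * ramanujan_sum n a else 0) sums
    (\<Prod>p\<in>F. \<Sum>K = 0..multiplicity p a. of_nat p ^ K * (G (p ^ K) - G (p ^ (K + 1))))"
    (is "_ sums ?P")
proof -
  have "(\<lambda>n. if n \<in> smooth_numbers F then G n * ramanujan_sum n a else 0) sums
    ((\<Prod>p\<in>F. \<Sum>k\<le>Suc (multiplicity p a). G (p ^ k) * ramanujan_sum (p ^ k) a) *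
     (G 1 * ramanujan_sum 1 a))"
    using assms
    by (intro sums_smooth_numbers[OF multiplicative_function_ramanujan])
       (auto simp: ramanujan_sum_prime_power_eq_0)
  also have "(\<Prod>p\<in>F. \<Sum>k\<le>Suc (multiplicity p a). G (p ^ k) * ramanujan_sum (p ^ k) a) = ?P"
    using assms by (intro prod.cong sum_ramanujan_prime_powers) auto
  also have "?P * (G 1 * ramanujan_sum 1 a) = ?P"
  proof (cases "\<exists>n\<ge>1. G n \<noteq> 0")
    case True
    then have "G 1 = 1" using multiplicative_function_at_1[OF assms(1)] by blast
    then show ?thesis by (simp add: ramanujan_sum_1)
  next
    case False
    then have "G (p ^ k) = 0" if "p \<in> F" for p k
      using that assms(4) prime_gt_0_nat by (metis One_nat_def Suc_le_eq zero_less_power)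
    then have "?P = (\<Prod>p\<in>F. 0)"
      by (intro prod.cong refl sum.neutral) (simp del: power_Suc)
    with assms(2,3) have "?P = 0" by (simp add: card_gt_0_iff)
    then show ?thesis by simp
  qed
  finally show ?thesis .
qed

section \<open>From a modulus to its prime divisors, and the final identities\<close>

text \<open>Translates the condition (r, d) = 1 into coprimality to a finite set of primes, the form
  in which the Euler product is available.\<close>

lemma coprime_numbers_prime_factors:
  assumes "d > 0"
  shows "coprime_numbers (prime_factors d) = coprime_numbers {d}"
proof -
  have "coprime r d \<longleftrightarrow> (\<forall>p\<in>prime_factors d. coprime r p)" if "r > 0" for r
  proof
    assume "coprime r d"
    then show "\<forall>p\<in>prime_factors d. coprime r p"
      by (meson coprime_divisors dvd_refl in_prime_factors_imp_dvd)
  next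
    assume *: "\<forall>p\<in>prime_factors d. coprime r p"
    show "coprime r d"
    proof (rule ccontr)
      assume "\<not> coprime r d"
      then obtain p where "prime p" "p dvd r" "p dvd d"
        by (metis coprime_iff_gcd_eq_1 gcd_greatest_iff prime_factor_nat)
      with * assms show False
        by (metis coprime_absorb_right in_prime_factors_iff not_gr_zero not_prime_unit)
    qed
  qed
  then show ?thesis by (auto simp: coprime_numbers_def)
qed

theorem mainTheorem1:
  fixes G :: "nat \<Rightarrow> complex"
  assumes "multiplicative_function G"
  shows
    "(\<forall>F :: nat set.
        finite F \<longrightarrow> F \<noteq> {} \<longrightarrow> (\<forall>p\<in>F. prime p) \<longrightarrow>
        (\<forall>a\<ge>1. converges_over (coprime_numbers F) (\<lambda>r. G r * ramanujan_sum r a)) \<longrightarrow>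
        ramanujan_coefficient G \<and>
        (\<forall>a\<ge>1.
           converges_over (smooth_numbers F) (\<lambda>s. G s * ramanujan_sum s a) \<and>
           series_over {1..} (\<lambda>q. G q * ramanujan_sum q a) =
             series_over (smooth_numbers F) (\<lambda>s. G s * ramanujan_sum s a) *
             series_over (coprime_numbers F) (\<lambda>r. G r * ramanujan_sum r a) \<and>
           series_over (smooth_numbers F) (\<lambda>s. G s * ramanujan_sum s a) =
             (\<Prod>p\<in>F. \<Sum>K = 0..multiplicity p a. of_nat p ^ K * (G (p ^ K) - G (p ^ (K + 1)))) \<and>
           series_over {1..} (\<lambda>q. G q * ramanujan_sum q a) =
             (\<Prod>p\<in>F. \<Sum>K = 0..multiplicity p a. of_nat p ^ K * (G (p ^ K) - G (p ^ (K + 1)))) *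
             series_over (coprime_numbers F) (\<lambda>r. G r * ramanujan_sum r a))) \<and>
     ((\<exists>n\<ge>1. G n \<noteq> 0) \<longrightarrow>
      (\<forall>d\<ge>1. converges_over (coprime_numbers {d}) (\<lambda>r. G r * of_int (moebius_mu r))) \<longrightarrow>
      (\<forall>d\<ge>1.
         converges_over {1..} (\<lambda>q. G q * of_int (moebius_mu q)) \<and>
         series_over {1..} (\<lambda>q. G q * of_int (moebius_mu q)) =
           (\<Prod>p | prime p \<and> p dvd d. 1 - G p) *
           series_over (coprime_numbers {d}) (\<lambda>r. G r * of_int (moebius_mu r))))"
proof (intro conjI impI allI)
  fix F :: "nat set" and a :: nat
  assume F: "finite F" "F \<noteq> {}" "\<forall>p\<in>F. prime p"
    and conv: "\<forall>a\<ge>1. converges_over (coprime_numbers F) (\<lambda>r. G r * ramanujan_sum r a)"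
  \<comment> \<open>Stated for every \<open>a\<close>, not just the fixed one, because being a
    Ramanujan coefficient concerns all arguments.\<close>
  have sums: "(\<lambda>n. if n \<in> {1..} then G n * ramanujan_sum n a else 0) sums
    ((\<Prod>p\<in>F. \<Sum>K = 0..multiplicity p a. of_nat p ^ K * (G (p ^ K) - G (p ^ (K + 1)))) *
     series_over (coprime_numbers F) (\<lambda>r. G r * ramanujan_sum r a))" if "a \<ge> 1" for a
    using that conv by (intro ramanujan_expansion_euler_sums[OF assms F(1,3)]) auto
  show "ramanujan_coefficient G"
    using sums unfolding ramanujan_coefficient_def converges_over_def by (blast intro: sums_summable)
  assume "1 \<le> a"
  then have smooth: "(\<lambda>n. if n \<in> smooth_numbers F then G n * ramanujan_sum n a else 0) sums
    (\<Prod>p\<in>F. \<Sum>K = 0..multiplicity p a. of_nat p ^ K * (G (p ^ K) - G (p ^ (K + 1))))"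
    by (intro ramanujan_smooth_sums[OF assms F]) simp
  show "converges_over (smooth_numbers F) (\<lambda>s. G s * ramanujan_sum s a)"
    using smooth unfolding converges_over_def by (rule sums_summable)
  show euler: "series_over {1..} (\<lambda>q. G q * ramanujan_sum q a) =
      (\<Prod>p\<in>F. \<Sum>K = 0..multiplicity p a. of_nat p ^ K * (G (p ^ K) - G (p ^ (K + 1)))) *
      series_over (coprime_numbers F) (\<lambda>r. G r * ramanujan_sum r a)"
    using sums_unique[OF sums[OF \<open>1 \<le> a\<close>]] unfolding series_over_def[of "{1..}"] by (rule sym)
  show factor: "series_over (smooth_numbers F) (\<lambda>s. G s * ramanujan_sum s a) =
      (\<Prod>p\<in>F. \<Sum>K = 0..multiplicity p a. of_nat p ^ K * (G (p ^ K) - G (p ^ (K + 1))))"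
    using sums_unique[OF smooth] unfolding series_over_def by (rule sym)
  show "series_over {1..} (\<lambda>q. G q * ramanujan_sum q a) =
      series_over (smooth_numbers F) (\<lambda>s. G s * ramanujan_sum s a) *
      series_over (coprime_numbers F) (\<lambda>r. G r * ramanujan_sum r a)"
    unfolding factor by (rule euler)
next
  fix d :: nat
  assume "\<exists>n\<ge>1. G n \<noteq> 0"
    and conv: "\<forall>d\<ge>1. converges_over (coprime_numbers {d}) (\<lambda>r. G r * of_int (moebius_mu r))"
    and "1 \<le> d"
  \<comment> \<open>For \<open>a = 1\<close> all multiplicities are 0, so the local factor at
    \<open>p\<close> is \<open>G 1 - G p\<close>; this value of \<open>G 1\<close> turns it into
    \<open>1 - G p\<close>.\<close>
  then have G1: "G 1 = 1"
    using multiplicative_function_at_1[OF assms] by blast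
  \<comment> \<open>Rewrites whole summands, indicator included, so that convergence and value
    transfer together.\<close>
  have mu: "(\<lambda>n. if n \<in> A then G n * ramanujan_sum n 1 else 0) =
      (\<lambda>n. if n \<in> A then G n * of_int (moebius_mu n) else 0)" if "A \<subseteq> {1..}" for A
    using that by (auto simp: fun_eq_iff ramanujan_sum_at_1 simp del: One_nat_def)
  have C: "coprime_numbers {d} = coprime_numbers (prime_factors d)"
    using \<open>1 \<le> d\<close> by (simp add: coprime_numbers_prime_factors)
  have C1: "coprime_numbers {d} \<subseteq> {1..}"
    by (auto simp: coprime_numbers_def)
  have P: "{p. prime p \<and> p dvd d} = prime_factors d"
    using \<open>1 \<le> d\<close> by (auto simp: in_prime_factors_iff)
  have "converges_over (coprime_numbers {d}) (\<lambda>r. G r * ramanujan_sum r 1)"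
    using conv \<open>1 \<le> d\<close> unfolding converges_over_def mu[OF C1] by blast
  then have "(\<lambda>n. if n \<in> {1..} then G n * ramanujan_sum n 1 else 0) sums
    ((\<Prod>p\<in>prime_factors d. \<Sum>K = 0..multiplicity p 1. of_nat p ^ K * (G (p ^ K) - G (p ^ (K + 1)))) *
     series_over (coprime_numbers {d}) (\<lambda>r. G r * ramanujan_sum r 1))"
    unfolding C by (intro ramanujan_expansion_euler_sums[OF assms]) auto
  then have *: "(\<lambda>n. if n \<in> {1..} then G n * of_int (moebius_mu n) else 0) sums
    ((\<Prod>p | prime p \<and> p dvd d. 1 - G p) *
     series_over (coprime_numbers {d}) (\<lambda>r. G r * of_int (moebius_mu r)))"
    unfolding series_over_def mu[OF C1] mu[OF order_refl] P using G1 by simp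
  show "converges_over {1..} (\<lambda>q. G q * of_int (moebius_mu q))"
    using * unfolding converges_over_def by (rule sums_summable)
  show "series_over {1..} (\<lambda>q. G q * of_int (moebius_mu q)) =
      (\<Prod>p | prime p \<and> p dvd d. 1 - G p) *
      series_over (coprime_numbers {d}) (\<lambda>r. G r * of_int (moebius_mu r))"
    using sums_unique[OF *] unfolding series_over_def[of "{1..}"] by (rule sym)
qed

end
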